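(* Let $F$ be a field of characteristic different from $2$, let $n\geq 4$, and let $UT_n=UT_n(F)$ be endowed with the canonical $\mathbb{Z}_n$-grading and the reflexive involution $r$. Then the image of the multilinear graded polynomial $f(y_{1,\overline{0}},y_{2,\overline{1}})=y_{1,\overline{0}}\,y_{2,\overline{1}}$ on $UT_n$, that is, the set $\{AB: A\in\mathcal{S}_{\overline{0}},\ B\in\mathcal{S}_{\overline{1}}\}$, is not a vector space.
   Context: $UT_n(F)$ is the algebra of $n\times n$ upper triangular matrices over $F$, with matrix units $e_{ij}$. The canonical (natural) $\mathbb{Z}_n$-grading on $UT_n$ is the one in which $e_{ij}$ ($i\le j$) is homogeneous of degree $\overline{j-i}\in\mathbb{Z}_n$; its homogeneous components are denoted $\mathcal{A}_{\overline{k}}$. The reflexive involution is $A^{r}=JA^{t}J$ with $J=e_{1n}+e_{2,n-1}+\cdots+e_{n1}$, i.e. the linear map with $e_{ij}\mapsto e_{n+1-j,n+1-i}$; it preserves each homogeneous component. $\mathcal{S}_{\overline{k}}=\{A\in\mathcal{A}_{\overline{k}}: A^r=A\}$, and the variable $y_{i,\overline{k}}$ is evaluated on $\mathcal{S}_{\overline{k}}$. *)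

theory Defs
  imports "Jordan_Normal_Form.VS_Connect" "HOL-Number_Theory.Cong"
begin

text \<open>
  Rows and columns of the type \<open>mat\<close> are indexed from 0, so the unit written here with indices
  \<open>i, j\<close> is $e_{i+1,j+1}$ in the usual 1-based notation; differences \<open>j - i\<close> are unaffected.
\<close>

definition UT :: "nat \<Rightarrow> 'a::field mat set"
  where "UT n = {A \<in> carrier_mat n n. upper_triangular A}"

definition munit :: "nat \<Rightarrow> nat \<Rightarrow> nat \<Rightarrow> 'a::field mat"
  where "munit n i j = mat n n (\<lambda>(k, l). if k = i \<and> l = j then 1 else 0)"

text \<open>
  The residue class in $\mathbb{Z}_n$ is given by any representative \<open>k\<close>; the subtraction on
  \<open>nat\<close> is exact because \<open>i \<le> j\<close>.
\<close>

definition UT_component :: "nat \<Rightarrow> nat \<Rightarrow> 'a::field mat set"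
  where "UT_component n k =
    LinearCombinations.module.span class_ring (module_mat TYPE('a) n n)
      {munit n i j | i j. i \<le> j \<and> j < n \<and> [j - i = k] (mod n)}"

definition antidiag :: "nat \<Rightarrow> 'a::field mat"
  where "antidiag n = mat n n (\<lambda>(i, j). if i + j = n - 1 then 1 else 0)"

definition reflexive_inv :: "nat \<Rightarrow> 'a::field mat \<Rightarrow> 'a mat"
  where "reflexive_inv n A = antidiag n * transpose_mat A * antidiag n"

definition UT_symmetric :: "nat \<Rightarrow> nat \<Rightarrow> 'a::field mat set"
  where "UT_symmetric n k = {A \<in> UT_component n k. reflexive_inv n A = A}"

lemma UT_component_iff:
  fixes A :: "'a::field mat"
  shows "A \<in> UT_component n k \<longleftrightarrow>
    A \<in> UT n \<and> (\<forall>i j. i \<le> j \<longrightarrow> j < n \<longrightarrow> A $$ (i, j) \<noteq> 0 \<longrightarrow> [j - i = k] (mod n))"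
proof -
  let ?V = "module_mat TYPE('a) n n" and ?K = "class_ring :: 'a ring"
  let ?S = "{munit n i j :: 'a mat | i j. i \<le> j \<and> j < n \<and> [j - i = k] (mod n)}"
  let ?N = "{A :: 'a mat. A \<in> UT n \<and>
    (\<forall>i j. i \<le> j \<longrightarrow> j < n \<longrightarrow> A $$ (i, j) \<noteq> 0 \<longrightarrow> [j - i = k] (mod n))}"
  interpret vectorspace ?K ?V by (rule matrix_vs)
  have S: "?S \<subseteq> carrier ?V" by (auto simp: module_mat_simps munit_def)
  have N: "LinearCombinations.submodule ?K ?N ?V"
  proof (unfold_locales, goal_cases)
    case (2 A B)
    show ?case
    proof (simp add: module_mat_simps, intro conjI allI impI)
      show "A + B \<in> UT n" using 2 by (auto simp: UT_def upper_triangular_def)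
      fix i j assume *: "i \<le> j" "j < n" "(A + B) $$ (i, j) \<noteq> 0"
      have "(A + B) $$ (i, j) = A $$ (i, j) + B $$ (i, j)"
        using 2 * by (auto simp: UT_def)
      with * have "A $$ (i, j) \<noteq> 0 \<or> B $$ (i, j) \<noteq> 0" by auto
      with 2 * show "[j - i = k] (mod n)" by blast
    qed
  next
    case (4 c A)
    show ?case
    proof (simp add: module_mat_simps, intro conjI allI impI)
      show "c \<cdot>\<^sub>m A \<in> UT n" using 4 by (auto simp: UT_def upper_triangular_def)
      fix i j assume *: "i \<le> j" "j < n" "(c \<cdot>\<^sub>m A) $$ (i, j) \<noteq> 0"
      have "(c \<cdot>\<^sub>m A) $$ (i, j) = c * A $$ (i, j)" using 4 * by (auto simp: UT_def)
      with * have "A $$ (i, j) \<noteq> 0" by auto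
      with 4 * show "[j - i = k] (mod n)" by blast
    qed
  qed (auto simp: module_mat_simps UT_def)
  have sub: "?S \<subseteq> ?N"
    by (auto simp: munit_def UT_def upper_triangular_def split: if_splits)
  have 1: "UT_component n k \<subseteq> ?N"
    unfolding UT_component_def by (rule span_is_subset[OF sub N])
  interpret W: LinearCombinations.submodule ?K "UT_component n k :: 'a mat set" ?V
    unfolding UT_component_def by (rule span_is_submodule[OF S])
  have 2: "A \<in> UT_component n k" if A: "A \<in> ?N" for A
  proof -
    define part :: "(nat \<times> nat) set \<Rightarrow> 'a mat"
      where "part P = mat n n (\<lambda>p. if p \<in> P then A $$ p else 0)" for P
    have "part P \<in> UT_component n k" if "finite P" for P
      using that
    proof induction
      case empty
      have "part {} = 0\<^sub>m n n" by (auto simp: part_def)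
      then show ?case using W.zero_closed by (simp add: module_mat_simps)
    next
      case (insert p P)
      obtain i j where p: "p = (i, j)" by force
      let ?u = "munit n i j :: 'a mat"
      show ?case
      proof (cases "i < n \<and> j < n \<and> A $$ (i, j) \<noteq> 0")
        case True
        with A have "i \<le> j" by (auto simp: UT_def upper_triangular_def not_le[symmetric])
        from True A \<open>i \<le> j\<close> have "?u \<in> ?S" by blast
        then have "?u \<in> UT_component n k"
          unfolding UT_component_def by (rule subsetD[OF in_own_span[OF S]])
        from W.smult_closed[OF _ this, of "A $$ (i, j)"]
        have "A $$ (i, j) \<cdot>\<^sub>m ?u \<in> UT_component n k" by (simp add: module_mat_simps)
        from W.m_closed[OF insert.IH this]
        have "part P + A $$ (i, j) \<cdot>\<^sub>m ?u \<in> UT_component n k"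
          by (simp add: module_mat_simps)
        also have "part P + A $$ (i, j) \<cdot>\<^sub>m ?u = part (insert p P)"
          using insert.hyps p by (intro eq_matI) (auto simp: part_def munit_def)
        finally show ?thesis .
      next
        case False
        then have "part (insert p P) = part P"
          using p by (intro eq_matI) (auto simp: part_def)
        with insert.IH show ?thesis by simp
      qed
    qed
    from this[of "{..<n} \<times> {..<n}"] have "part ({..<n} \<times> {..<n}) \<in> UT_component n k" by simp
    also have "part ({..<n} \<times> {..<n}) = A"
      using A by (intro eq_matI) (auto simp: part_def UT_def)
    finally show ?thesis .
  qed
  have "UT_component n k = ?N" using 1 2 by (intro equalityI subsetI) (erule subsetD, assumption)
  then show ?thesis by simp
qed

lemma reflexive_inv_munit:
  assumes "i < n" "j < n"
  shows "reflexive_inv n (munit n i j :: 'a::field mat) = munit n (n - 1 - j) (n - 1 - i)"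
proof -
  let ?P = "antidiag n * transpose_mat (munit n i j) :: 'a mat"
  have P: "?P = munit n (n - 1 - j) i"
  proof (rule eq_matI)
    fix a b assume "a < dim_row (munit n (n - 1 - j) i :: 'a mat)"
      "b < dim_col (munit n (n - 1 - j) i :: 'a mat)"
    then have ab: "a < n" "b < n" by (auto simp: munit_def)
    have "?P $$ (a, b) = (\<Sum>k = 0..<n.
        (if a + k = n - 1 then 1 else 0) * (if b = i \<and> k = j then 1 else 0))"
      using ab by (simp add: antidiag_def munit_def scalar_prod_def)
    also have "\<dots> = (\<Sum>k = 0..<n. if k = j then (if a + j = n - 1 \<and> b = i then 1 else 0) else 0)"
      by (intro sum.cong) auto
    also have "\<dots> = (if a + j = n - 1 \<and> b = i then 1 else 0)" using assms by simp
    also have "\<dots> = (munit n (n - 1 - j) i :: 'a mat) $$ (a, b)"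
      using ab assms by (auto simp: munit_def)
    finally show "?P $$ (a, b) = (munit n (n - 1 - j) i :: 'a mat) $$ (a, b)" .
  qed (auto simp: antidiag_def munit_def)
  show ?thesis unfolding reflexive_inv_def P
  proof (rule eq_matI)
    let ?Q = "munit n (n - 1 - j) i * antidiag n :: 'a mat"
    fix a b assume "a < dim_row (munit n (n - 1 - j) (n - 1 - i) :: 'a mat)"
      "b < dim_col (munit n (n - 1 - j) (n - 1 - i) :: 'a mat)"
    then have ab: "a < n" "b < n" by (auto simp: munit_def)
    have "?Q $$ (a, b) = (\<Sum>k = 0..<n.
        (if a = n - 1 - j \<and> k = i then 1 else 0) * (if k + b = n - 1 then 1 else 0))"
      using ab by (simp add: antidiag_def munit_def scalar_prod_def)
    also have "\<dots> =
        (\<Sum>k = 0..<n. if k = i then (if a = n - 1 - j \<and> i + b = n - 1 then 1 else 0) else 0)"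
      by (intro sum.cong) auto
    also have "\<dots> = (if a = n - 1 - j \<and> i + b = n - 1 then 1 else 0)" using assms by simp
    also have "\<dots> = (munit n (n - 1 - j) (n - 1 - i) :: 'a mat) $$ (a, b)"
      using ab assms by (auto simp: munit_def)
    finally show "?Q $$ (a, b) = (munit n (n - 1 - j) (n - 1 - i) :: 'a mat) $$ (a, b)" .
  qed (auto simp: antidiag_def munit_def)
qed

end

theory Submission
  imports Defs
begin

text \<open>
  With 0-based indices, a symmetric matrix \<open>A\<close> of degree 0 is diagonal with entries
  \<open>a\<^sub>i = a\<^sub>n\<^sub>-\<^sub>1\<^sub>-\<^sub>i\<close>, and a symmetric matrix \<open>B\<close> of degree 1 lives on the superdiagonal with entries
  \<open>b\<^sub>i = b\<^sub>n\<^sub>-\<^sub>2\<^sub>-\<^sub>i\<close> in position \<open>(i, i + 1)\<close>; the product \<open>A * B\<close> has superdiagonal entries \<open>a\<^sub>i b\<^sub>i\<close>.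
  Every single superdiagonal matrix unit is such a product (\<open>symmetrized_unit_mult\<close>), so if the image
  were a subspace, it would contain \<open>munit n 0 1 + munit n 1 2\<close>. It does not: because \<open>a\<^sub>n\<^sub>-\<^sub>2 = a\<^sub>1\<close> and
  \<open>b\<^sub>n\<^sub>-\<^sub>2 = b\<^sub>0\<close>, the last superdiagonal entry of a product is \<open>a\<^sub>1 b\<^sub>0\<close>, and it cannot vanish when
  the first two entries \<open>a\<^sub>0 b\<^sub>0\<close> and \<open>a\<^sub>1 b\<^sub>1\<close> are both nonzero. For \<open>n \<ge> 4\<close> this last entry,
  in position \<open>(n - 2, n - 1)\<close>, is distinct from the first two, so the sum has a zero there.
\<close>

lemma reflexive_inv_index:
  fixes A :: "'a::field mat"
  assumes A: "A \<in> carrier_mat n n" and "i < n" "j < n"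
  shows "reflexive_inv n A $$ (i, j) = A $$ (n - 1 - j, n - 1 - i)"
proof -
  let ?P = "antidiag n * transpose_mat A :: 'a mat"
  have P: "?P $$ (i, k) = A $$ (k, n - 1 - i)" if "k < n" for k
  proof -
    have "?P $$ (i, k) = (\<Sum>l = 0..<n. (if i + l = n - 1 then 1 else 0) * A $$ (k, l))"
      using A that \<open>i < n\<close> by (simp add: antidiag_def scalar_prod_def)
    also have "\<dots> = (\<Sum>l = 0..<n. if l = n - 1 - i then A $$ (k, l) else 0)"
      using \<open>i < n\<close> by (intro sum.cong) auto
    finally show ?thesis using \<open>i < n\<close> by simp
  qed
  have "reflexive_inv n A $$ (i, j)
      = (\<Sum>k = 0..<n. ?P $$ (i, k) * (if k + j = n - 1 then 1 else 0))"
    using A \<open>i < n\<close> \<open>j < n\<close>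
    by (simp add: reflexive_inv_def scalar_prod_def antidiag_def)
  also have "\<dots> = (\<Sum>k = 0..<n. if k = n - 1 - j then A $$ (k, n - 1 - i) else 0)"
    using P \<open>j < n\<close> by (intro sum.cong) auto
  finally show ?thesis using \<open>j < n\<close> by simp
qed

lemma UT_symmetric_iff:
  fixes A :: "'a::field mat"
  shows "A \<in> UT_symmetric n k \<longleftrightarrow>
    A \<in> UT_component n k \<and> (\<forall>i<n. \<forall>j<n. A $$ (n - 1 - j, n - 1 - i) = A $$ (i, j))"
proof (cases "A \<in> UT_component n k")
  case True
  then have A: "A \<in> carrier_mat n n" by (simp add: UT_component_iff UT_def)
  have "reflexive_inv n A \<in> carrier_mat n n"
    by (rule carrier_matI) (simp_all add: reflexive_inv_def antidiag_def)
  with A have "reflexive_inv n A = A \<longleftrightarrow>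
      (\<forall>i<n. \<forall>j<n. reflexive_inv n A $$ (i, j) = A $$ (i, j))"
    by (auto intro!: eq_matI)
  with True A show ?thesis by (simp add: UT_symmetric_def reflexive_inv_index)
qed (simp add: UT_symmetric_def)

lemma UT_symmetric_carrier: "A \<in> UT_symmetric n k \<Longrightarrow> A \<in> carrier_mat n n"
  by (simp add: UT_symmetric_def UT_component_iff UT_def)

text \<open>
  In degree 0 the congruence \<open>j - i = 0\<close> modulo \<open>n\<close> forces \<open>i = j\<close>, so the left factor is diagonal.
\<close>

lemma UT_symmetric_0_mult_index:
  fixes A B :: "'a::field mat"
  assumes A: "A \<in> UT_symmetric n 0" and B: "B \<in> carrier_mat n n" and "i < n" "j < n"
  shows "(A * B) $$ (i, j) = A $$ (i, i) * B $$ (i, j)"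
proof -
  have off: "A $$ (i, k) = 0" if "k < n" "k \<noteq> i" for k
  proof (cases "k < i")
    case True
    with A \<open>i < n\<close> show ?thesis
      by (auto simp: UT_symmetric_def UT_component_iff UT_def upper_triangular_def)
  next
    case False
    with that have "\<not> [k - i = 0] (mod n)" by (auto simp: cong_def)
    moreover have "A \<in> UT_component n 0" using A by (simp add: UT_symmetric_def)
    ultimately show ?thesis using False that unfolding UT_component_iff by (meson not_less)
  qed
  have "(A * B) $$ (i, j) = (\<Sum>k = 0..<n. A $$ (i, k) * B $$ (k, j))"
    using UT_symmetric_carrier[OF A] B \<open>i < n\<close> \<open>j < n\<close> by (simp add: scalar_prod_def)
  also have "\<dots> = (\<Sum>k = 0..<n. if k = i then A $$ (k, k) * B $$ (k, j) else 0)"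
    using off by (intro sum.cong) auto
  finally show ?thesis using \<open>i < n\<close> by simp
qed

text \<open>
  A matrix unit fixed by the involution has to occur here with coefficient 1 and not 2, so this is
  the indicator of an orbit of positions rather than the sum of a unit and its image.
\<close>

definition symmetrized_unit :: "nat \<Rightarrow> nat \<Rightarrow> nat \<Rightarrow> 'a::field mat"
  where "symmetrized_unit n i j =
    mat n n (\<lambda>p. if p = (i, j) \<or> p = (n - 1 - j, n - 1 - i) then 1 else 0)"

lemma symmetrized_unit_symmetric:
  assumes "i \<le> j" "j < n"
  shows "(symmetrized_unit n i j :: 'a::field mat) \<in> UT_symmetric n (j - i)"
  unfolding UT_symmetric_iff UT_component_iff using assms
  by (auto simp: symmetrized_unit_def UT_def upper_triangular_def split: if_splits)

text \<open>
  The diagonal factor selects the rows \<open>i\<close> and \<open>n - 1 - i\<close>, whereas the other factor is supported in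
  the rows \<open>i\<close> and \<open>n - 2 - i\<close>. Only row \<open>i\<close> is common to both, also when some of these
  indices coincide.
\<close>

lemma symmetrized_unit_mult:
  assumes "i + 1 < n"
  shows "symmetrized_unit n i i * symmetrized_unit n i (i + 1) = (munit n i (i + 1) :: 'a::field mat)"
proof (rule eq_matI)
  fix k l
  assume "k < dim_row (munit n i (i + 1) :: 'a mat)" "l < dim_col (munit n i (i + 1) :: 'a mat)"
  then have kl: "k < n" "l < n" by (auto simp: munit_def)
  have "(symmetrized_unit n i i :: 'a mat) \<in> UT_symmetric n 0"
    using symmetrized_unit_symmetric[of i i n] assms by simp
  from UT_symmetric_0_mult_index[OF this _ kl, of "symmetrized_unit n i (i + 1)"]
  show "(symmetrized_unit n i i * symmetrized_unit n i (i + 1)) $$ (k, l)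
      = (munit n i (i + 1) :: 'a mat) $$ (k, l)"
    using kl assms by (auto simp: symmetrized_unit_def munit_def)
qed (auto simp: symmetrized_unit_def munit_def)

theorem proposition4p8:
  fixes n :: nat
  assumes "CHAR('a::field) \<noteq> 2" and "n \<ge> 4"
  shows "\<not> VectorSpace.subspace class_ring
    {A * B | A B :: 'a mat. A \<in> UT_symmetric n 0 \<and> B \<in> UT_symmetric n 1}
    (module_mat TYPE('a) n n)"
proof
  let ?I = "{A * B | A B :: 'a mat. A \<in> UT_symmetric n 0 \<and> B \<in> UT_symmetric n 1}"
  let ?C = "munit n 0 1 + munit n 1 2 :: 'a mat"
  assume "VectorSpace.subspace class_ring ?I (module_mat TYPE('a) n n)"
  then interpret W: LinearCombinations.submodule class_ring ?I "module_mat TYPE('a) n n"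
    by (simp add: VectorSpace.subspace_def)
  have unit_in: "munit n i (i + 1) \<in> ?I" if "i + 1 < n" for i
    using symmetrized_unit_mult[OF that, where 'a = 'a]
      symmetrized_unit_symmetric[of i i n, where 'a = 'a]
      symmetrized_unit_symmetric[of i "i + 1" n, where 'a = 'a] that
    by (intro CollectI exI[of _ "symmetrized_unit n i i"]
        exI[of _ "symmetrized_unit n i (i + 1)"]) simp
  have "munit n 0 1 \<in> ?I" "munit n 1 2 \<in> ?I"
    using unit_in[of 0] unit_in[of 1] \<open>n \<ge> 4\<close> by (simp_all add: numeral_2_eq_2)
  from W.m_closed[OF this] have "?C \<in> ?I" by (simp add: module_mat_simps)
  then obtain A B :: "'a mat" where AB: "?C = A * B"
    and A: "A \<in> UT_symmetric n 0" and B: "B \<in> UT_symmetric n 1" by blast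
  have C: "?C $$ (i, j) = A $$ (i, i) * B $$ (i, j)" if "i < n" "j < n" for i j
    unfolding AB by (rule UT_symmetric_0_mult_index[OF A UT_symmetric_carrier[OF B] that])
  have "A $$ (0, 0) * B $$ (0, 1) = 1" "A $$ (1, 1) * B $$ (1, 2) = 1"
    using C[of 0 1] C[of 1 2] \<open>n \<ge> 4\<close> by (simp_all add: munit_def)
  then have nonzero: "A $$ (1, 1) \<noteq> 0" "B $$ (0, 1) \<noteq> 0" by auto
  have "A $$ (n - 1 - 1, n - 1 - 1) = A $$ (1, 1)"
    using A \<open>n \<ge> 4\<close> unfolding UT_symmetric_iff by simp
  moreover have "B $$ (n - 1 - 1, n - 1 - 0) = B $$ (0, 1)"
    using B \<open>n \<ge> 4\<close> unfolding UT_symmetric_iff by simp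
  moreover have "?C $$ (n - 1 - 1, n - 1 - 0) = 0"
    using \<open>n \<ge> 4\<close> by (simp add: munit_def)
  ultimately have "A $$ (1, 1) * B $$ (0, 1) = 0"
    using C[of "n - 1 - 1" "n - 1 - 0"] \<open>n \<ge> 4\<close> by simp
  with nonzero show False by simp
qed

end
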